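(* Let $V$ be a complex vector space and let $\phi:V\to V$ be a non-commutative power series satisfying $\phi_1=\mathrm{id}_V$. Then $\phi$ is invertible for composition, $(\phi^{-1})_1=\mathrm{id}_V$ and, for $n>1$ and $v_1,\ldots,v_n\in V$, $$(\phi^{-1})_n(v_1,\ldots,v_n)=\sum_T(-1)^{|V(T)|}\,\phi_T(v_1,\ldots,v_n),$$ where the sum is over rooted plane trees $T$ with $n$ leaves all of whose vertices have valency $\ge3$, and $V(T)$ is the set of vertices of $T$.
   Context: A non-commutative (NC) power series $\phi:U\to V$ between complex vector spaces is a sequence of linear maps $\phi_n:U^{\otimes n}\to V$, $n\ge1$. The composite of $\phi:U\to V$ and $\psi:V\to W$ is $$(\psi\circ\phi)_n(u_1,\ldots,u_n)=\sum_{k=1}^n\ \sum_{0=i_0<\cdots<i_k=n}\psi_k\big(\phi_{i_1-i_0}(u_{i_0+1},\ldots,u_{i_1}),\ldots,\phi_{i_k-i_{k-1}}(u_{i_{k-1}+1},\ldots,u_{i_k})\big).$$ Composition is associative, with identity $\mathrm{id}_V$ given by $\mathrm{id}_1=\mathrm{id}_V$, $\mathrm{id}_n=0$ for $n>1$; inverses are with respect to this composition. A plane tree is a finite tree, possibly with external edges (edges having a vertex at only one end), with a cyclic ordering of the edges incident at each vertex. A rooted plane tree has a distinguished external edge, the root; the other external edges are its leaves (endpoints of external edges are not counted as vertices). At each vertex exactly one incident edge points towards the root, and the other (incoming) edges are linearly ordered; the leaves are likewise linearly ordered. For a rooted plane tree $T$ with $n$ leaves, $\phi_T:V^{\otimes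 n}\to V$ is obtained by placing $v_1,\ldots,v_n$ on the leaves in order and applying $\phi_k$ at each vertex with $k$ incoming edges (valency $k+1$), the output being read at the root. *)

theory Defs
  imports Complex_Main
begin

text \<open>
  A non-commutative power series from \<open>U\<close> to \<open>V\<close> is encoded as a single function on lists:
  \<open>\<phi>\<^sub>n\<close> is its restriction to lists of length \<open>n\<close>, and a linear map on the \<open>n\<close>-th tensor power
  of \<open>U\<close> is given as an \<open>n\<close>-linear map on \<open>U\<close>. There is no component in degree 0; the value at
  the empty list is normalised to 0, so that equality of series is equality of functions.
\<close>

definition nc_series ::
  "(complex \<Rightarrow> 'u \<Rightarrow> 'u) \<Rightarrow> (complex \<Rightarrow> 'v \<Rightarrow> 'v) \<Rightarrow>
    ('u::ab_group_add list \<Rightarrow> 'v::ab_group_add) \<Rightarrow> bool"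
where
  "nc_series sU sV \<phi> \<longleftrightarrow>
     \<phi> [] = 0 \<and> (\<forall>xs ys. Vector_Spaces.linear sU sV (\<lambda>u. \<phi> (xs @ u # ys)))"

definition nc_id :: "'v list \<Rightarrow> 'v::ab_group_add" where
  "nc_id vs = (if length vs = 1 then hd vs else 0)"

text \<open>
  The list \<open>is\<close> is the sequence of cut points \<open>0 = i\<^sub>0 < \<dots> < i\<^sub>k = n\<close>, and
  \<open>take (b - a) (drop a us)\<close> is the block \<open>u\<^sub>a\<^sub>+\<^sub>1, \<dots>, u\<^sub>b\<close> (in 1-based numbering).
\<close>

definition nc_comp ::
  "('v list \<Rightarrow> 'w) \<Rightarrow> ('u list \<Rightarrow> 'v) \<Rightarrow> 'u list \<Rightarrow> 'w::ab_group_add"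
where
  "nc_comp \<psi> \<phi> us =
     (\<Sum>k = 1..length us.
        \<Sum>is | length is = k + 1 \<and> is ! 0 = 0 \<and> is ! k = length us \<and> sorted_wrt (<) is.
          \<psi> (map (\<lambda>j. \<phi> (take (is ! (j + 1) - is ! j) (drop (is ! j) us))) [0..<k]))"

definition nc_inverse ::
  "(complex \<Rightarrow> 'u \<Rightarrow> 'u) \<Rightarrow> (complex \<Rightarrow> 'v \<Rightarrow> 'v) \<Rightarrow>
    ('u::ab_group_add list \<Rightarrow> 'v::ab_group_add) \<Rightarrow> ('v list \<Rightarrow> 'u) \<Rightarrow> bool"
where
  "nc_inverse sU sV \<phi> \<psi> \<longleftrightarrow>
     nc_series sV sU \<psi> \<and> nc_comp \<psi> \<phi> = nc_id \<and> nc_comp \<phi> \<psi> = nc_id"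

definition nc_invertible ::
  "(complex \<Rightarrow> 'u \<Rightarrow> 'u) \<Rightarrow> (complex \<Rightarrow> 'v \<Rightarrow> 'v) \<Rightarrow>
    ('u::ab_group_add list \<Rightarrow> 'v::ab_group_add) \<Rightarrow> bool"
where
  "nc_invertible sU sV \<phi> \<longleftrightarrow> (\<exists>\<psi>. nc_inverse sU sV \<phi> \<psi>)"

definition nc_inv ::
  "(complex \<Rightarrow> 'u \<Rightarrow> 'u) \<Rightarrow> (complex \<Rightarrow> 'v \<Rightarrow> 'v) \<Rightarrow>
    ('u::ab_group_add list \<Rightarrow> 'v::ab_group_add) \<Rightarrow> 'v list \<Rightarrow> 'u"
where
  "nc_inv sU sV \<phi> = (THE \<psi>. nc_inverse sU sV \<phi> \<psi>)"

text \<open>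
  Rooted plane trees up to isomorphism. An element stands for a rooted tree seen from its root
  edge: \<open>Leaf\<close> if that edge comes from no vertex, and \<open>Vertex ts\<close> if it comes from a vertex whose
  incoming edges are, in order, the root edges of the trees \<open>ts\<close>. The cyclic order at a vertex is
  the order of \<open>ts\<close> with the outgoing edge put in front. \<open>Vertex []\<close> is a vertex of valency 1,
  not a leaf; \<open>Leaf\<close> on its own is the tree without vertices.
\<close>

datatype plane_tree = Leaf | Vertex "plane_tree list"

primrec num_leaves :: "plane_tree \<Rightarrow> nat" where
  "num_leaves Leaf = 1"
| "num_leaves (Vertex ts) = sum_list (map num_leaves ts)"

text \<open>A vertex is identified with the path that leads to it from the root.\<close>

primrec vertices :: "plane_tree \<Rightarrow> nat list set" where
  "vertices Leaf = {}"
| "vertices (Vertex ts) = insert [] (\<Union>i<length ts. (#) i ` (map vertices ts ! i))"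

text \<open>Only the values at elements of \<open>vertices T\<close> are meaningful.\<close>

fun valency :: "plane_tree \<Rightarrow> nat list \<Rightarrow> nat" where
  "valency (Vertex ts) [] = length ts + 1"
| "valency (Vertex ts) (i # p) = valency (ts ! i) p"
| "valency Leaf p = 0"

text \<open>
  The map \<open>\<phi>\<^sub>T\<close>, for argument lists of length \<open>num_leaves T\<close>; the arguments are dealt out to
  the subtrees from left to right.
\<close>

fun tree_map :: "('v list \<Rightarrow> 'v) \<Rightarrow> plane_tree \<Rightarrow> 'v list \<Rightarrow> 'v"
  and forest_map :: "('v list \<Rightarrow> 'v) \<Rightarrow> plane_tree list \<Rightarrow> 'v list \<Rightarrow> 'v list"
where
  "tree_map \<phi> Leaf vs = hd vs"
| "tree_map \<phi> (Vertex ts) vs = \<phi> (forest_map \<phi> ts vs)"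
| "forest_map \<phi> [] vs = []"
| "forest_map \<phi> (t # ts) vs =
     tree_map \<phi> t (take (num_leaves t) vs) # forest_map \<phi> ts (drop (num_leaves t) vs)"

end

theory Submission
  imports Defs
begin

text \<open>
  Absorb the sign \<open>(-1)\<close> of each vertex into the series, i.e. evaluate trees with \<open>-\<phi>\<close>, and let
  \<open>\<psi>\<close> be the sum over all reduced trees (every vertex of valency at least 3). Cutting a tree at its
  root vertex gives \<open>\<psi> = id - (\<phi>\<^sub>2 + \<phi>\<^sub>3 + \<dots>) \<circ> \<psi>\<close>, which says \<open>\<phi> \<circ> \<psi> = id\<close>.
  Since \<open>\<psi>\<close> again has linear part \<open>id\<close>, it has a right inverse \<open>\<chi>\<close> of the same kind, and
  associativity gives \<open>\<phi> = \<phi> \<circ> (\<psi> \<circ> \<chi>) = \<chi>\<close>, so \<open>\<psi>\<close> is a two-sided inverse.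
\<close>

section \<open>Composition as a sum over block decompositions\<close>

text \<open>Decompositions are recorded by their blocks instead of their cut points, so that nesting
  two of them and applying a series blockwise become plain \<open>concat\<close> and
  \<open>map\<close>.\<close>

definition splits :: "'a list \<Rightarrow> 'a list list set" where
  "splits us = {xss. concat xss = us \<and> [] \<notin> set xss}"

lemma length_le_length_concat: "[] \<notin> set xss \<Longrightarrow> length xss \<le> length (concat xss)"
proof (induction xss)
  case (Cons xs xss)
  then have "length xs \<ge> 1" by (cases xs) auto
  then show ?case using Cons by auto
qed simp

lemma finite_splits: "finite (splits us)"
proof (rule finite_subset)
  have "length xs \<le> length (concat xss)" if "xs \<in> set xss" for xs and xss :: "'a list list"
    using that by (induction xss) auto
  then show "splits us \<subseteq> {xss. set xss \<subseteq> {xs. set xs \<subseteq> set us \<and> length xs \<le> length us} \<and> length xss \<le> length us}"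
    unfolding splits_def using length_le_length_concat by fastforce
  show "finite {xss. set xss \<subseteq> {xs. set xs \<subseteq> set us \<and> length xs \<le> length us} \<and> length xss \<le> length us}"
    by (intro finite_lists_length_le) auto
qed

lemma splits_Nil: "splits [] = {[]}"
  by (auto simp: splits_def) (metis list.set_intros(1) neq_Nil_conv)

text \<open>The blocks telescope: appending the block from cut \<open>j\<close> to cut
  \<open>j + 1\<close> to the prefix ending at cut \<open>j\<close> gives the prefix ending at cut
  \<open>j + 1\<close>.\<close>

lemma concat_blocks:
  assumes "length is = k + 1" "is ! 0 = 0" "sorted_wrt (<) is" "j \<le> k"
  shows "concat (map (\<lambda>j. take (is ! (j + 1) - is ! j) (drop (is ! j) us)) [0..<j]) = take (is ! j) us"
  using assms(4)
proof (induction j)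
  case (Suc j)
  have "is ! j < is ! Suc j"
    using Suc.prems assms(1,3) sorted_wrt_nth_less[of "(<)" "is" j "Suc j"] by simp
  then show ?case using Suc by (simp flip: take_add)
qed (use assms in simp)

text \<open>Cut sequences and decompositions into \<open>k\<close> blocks are in bijection: the
  blocks are read off between consecutive cuts, and the \<open>j\<close>-th cut is recovered as the
  total length of the first \<open>j\<close> blocks. Strict increase of the cuts corresponds to
  nonempty blocks.\<close>

lemma sum_cuts_eq_sum_splits:
  fixes f :: "'a list list \<Rightarrow> 'b::comm_monoid_add"
  shows "(\<Sum>is | length is = k + 1 \<and> is ! 0 = 0 \<and> is ! k = length us \<and> sorted_wrt (<) is.
            f (map (\<lambda>j. take (is ! (j + 1) - is ! j) (drop (is ! j) us)) [0..<k])) =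
         (\<Sum>xss | xss \<in> splits us \<and> length xss = k. f xss)"
proof -
  define blocks where
    "blocks is = map (\<lambda>j. take (is ! (j + 1) - is ! j) (drop (is ! j) us)) [0..<k]" for "is" :: "nat list"
  define cuts where
    "cuts xss = map (\<lambda>j. length (concat (take j xss))) [0..<k + 1]" for xss :: "'a list list"
  define I where "I = {is. length is = k + 1 \<and> is ! 0 = 0 \<and> is ! k = length us \<and> sorted_wrt (<) is}"
  have nth_mono: "is ! i < is ! j" if "is \<in> I" "i < j" "j \<le> k" for "is" i j
    using that sorted_wrt_nth_less[of "(<)" "is" i j] by (simp add: I_def)
  have nth_le: "is ! j \<le> length us" if "is \<in> I" "j \<le> k" for "is" j
    using nth_mono[OF that(1), of j k] that by (cases "j = k") (auto simp: I_def)
  have concat_take: "concat (take j (blocks is)) = take (is ! j) us" if "is \<in> I" "j \<le> k" for "is" j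
    using concat_blocks[of "is" k j us] that by (simp add: blocks_def I_def take_map)
  have cuts_nth: "cuts xss ! j = length (concat (take j xss))" if "j \<le> k" for xss j
    using that by (simp add: cuts_def del: upt_Suc)
  have "(\<Sum>is\<in>I. f (blocks is)) = (\<Sum>xss | xss \<in> splits us \<and> length xss = k. f xss)"
  proof (rule sum.reindex_bij_witness[where i = cuts and j = blocks])
    fix "is" assume isI: "is \<in> I"
    show "cuts (blocks is) = is"
    proof (rule nth_equalityI)
      show "length (cuts (blocks is)) = length is" using isI by (simp add: cuts_def I_def)
      fix j assume "j < length (cuts (blocks is))"
      then have "j \<le> k" by (simp add: cuts_def)
      then show "cuts (blocks is) ! j = is ! j"
        using concat_take[OF isI, of j] nth_le[OF isI, of j] by (simp add: cuts_nth del: length_concat)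
    qed
    have "[] \<notin> set (blocks is)"
    proof
      assume "[] \<in> set (blocks is)"
      then obtain j where "j < k" "take (is ! (j + 1) - is ! j) (drop (is ! j) us) = []"
        by (auto simp: blocks_def)
      then show False
        using nth_mono[OF isI, of j "j + 1"] nth_le[OF isI, of "j + 1"] by auto
    qed
    moreover have "concat (blocks is) = us"
      using concat_take[OF isI, of k] isI by (simp add: blocks_def I_def)
    ultimately show "blocks is \<in> {xss. xss \<in> splits us \<and> length xss = k}"
      by (simp add: splits_def blocks_def)
  next
    fix xss assume "xss \<in> {xss. xss \<in> splits us \<and> length xss = k}"
    then have xss: "concat xss = us" "[] \<notin> set xss" "length xss = k" by (auto simp: splits_def)
    have split: "us = concat (take j xss) @ xss ! j @ concat (drop (Suc j) xss)" if "j < k" for j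
      using xss that by (metis concat.simps(2) concat_append id_take_nth_drop)
    have step: "concat (take (Suc j) xss) = concat (take j xss) @ xss ! j" if "j < k" for j
      using xss that by (simp add: take_Suc_conv_app_nth)
    show "blocks (cuts xss) = xss"
    proof (rule nth_equalityI)
      show "length (blocks (cuts xss)) = length xss" using xss by (simp add: blocks_def)
      fix j assume "j < length (blocks (cuts xss))"
      then have j: "j < k" by (simp add: blocks_def)
      have "cuts xss ! (j + 1) - cuts xss ! j = length (xss ! j)"
        using j step[OF j] by (simp add: cuts_nth del: length_concat)
      \<comment> \<open>Dropping everything before cut \<open>j\<close> leaves
        \<open>xss ! j\<close> at the front of \<open>us\<close>.\<close>
      then show "blocks (cuts xss) ! j = xss ! j"
        using j arg_cong[OF split[OF j], of "drop (cuts xss ! j)"]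
        by (simp add: blocks_def cuts_nth del: length_concat)
    qed
    have "sorted_wrt (<) (cuts xss)"
    proof -
      have "cuts xss ! j < cuts xss ! Suc j" if "Suc j < length (cuts xss)" for j
      proof -
        have j: "j < k" using that by (simp add: cuts_def)
        moreover have "xss ! j \<noteq> []" using xss j by (metis nth_mem)
        ultimately show ?thesis using step[OF j] by (simp add: cuts_nth del: length_concat)
      qed
      then show ?thesis by (simp add: sorted_wrt_iff_nth_Suc_transp)
    qed
    then show "cuts xss \<in> I"
      using xss by (simp add: I_def cuts_nth del: length_concat) (simp add: cuts_def)
  qed simp
  then show ?thesis by (simp add: blocks_def I_def)
qed

text \<open>The sum over \<open>k\<close> groups decompositions by their number of blocks. At the
  empty list the left side is an empty sum, while the right side has the single term
  \<open>\<psi> []\<close>; the hypothesis reconciles them.\<close>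

lemma nc_comp_eq_sum_splits:
  assumes "\<psi> [] = 0"
  shows "nc_comp \<psi> \<phi> us = (\<Sum>xss\<in>splits us. \<psi> (map \<phi> xss))"
proof (cases "us = []")
  case True
  then show ?thesis using assms by (simp add: nc_comp_def splits_Nil)
next
  case False
  have "nc_comp \<psi> \<phi> us = (\<Sum>k = 1..length us. \<Sum>xss | xss \<in> splits us \<and> length xss = k. \<psi> (map \<phi> xss))"
    unfolding nc_comp_def
    by (subst sum_cuts_eq_sum_splits[symmetric]) (simp add: comp_def)
  also have "\<dots> = (\<Sum>xss\<in>splits us. \<psi> (map \<phi> xss))"
  proof (rule sum.group)
    have "length xss \<in> {1..length us}" if "xss \<in> splits us" for xss
      using that False length_le_length_concat[of xss] by (cases xss) (auto simp: splits_def)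
    then show "length ` splits us \<subseteq> {1..length us}" by blast
  qed (auto simp: finite_splits)
  finally show ?thesis .
qed

section \<open>Associativity and units\<close>

text \<open>The part of multilinearity that distributes a series over sums; in this form
  associativity becomes a statement about abelian groups.\<close>

definition multiadditive :: "('u::ab_group_add list \<Rightarrow> 'v::ab_group_add) \<Rightarrow> bool" where
  "multiadditive \<chi> \<longleftrightarrow> (\<forall>xs ys. additive (\<lambda>u. \<chi> (xs @ u # ys)))"

text \<open>Full distributivity: expanding every argument amounts to choosing one summand in each.
  The prefix \<open>ws\<close> holds the arguments already expanded, so the induction can work from
  left to right.\<close>

lemma multiadditive_sum:
  assumes "multiadditive \<chi>" "\<And>a. a \<in> set as \<Longrightarrow> finite (S a)"
  shows "\<chi> (ws @ map (\<lambda>a. \<Sum>x\<in>S a. g a x) as) =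
    (\<Sum>xs | list_all2 (\<lambda>a x. x \<in> S a) as xs. \<chi> (ws @ map2 g as xs))"
  using assms(2)
proof (induction as arbitrary: ws)
  case (Cons a as)
  have add: "additive (\<lambda>u. \<chi> (ws @ u # map (\<lambda>a. \<Sum>x\<in>S a. g a x) as))"
    using assms(1) by (simp add: multiadditive_def)
  have "\<chi> (ws @ map (\<lambda>a. \<Sum>x\<in>S a. g a x) (a # as)) =
      (\<Sum>x\<in>S a. \<chi> (ws @ g a x # map (\<lambda>a. \<Sum>x\<in>S a. g a x) as))"
    using additive.sum[OF add, of "g a" "S a"] by simp
  also have "\<dots> = (\<Sum>x\<in>S a. \<Sum>xs | list_all2 (\<lambda>a x. x \<in> S a) as xs. \<chi> (ws @ g a x # map2 g as xs))"
    using Cons.IH[of "ws @ [g a x]" for x] Cons.prems by simp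
  also have "\<dots> = (\<Sum>xs | list_all2 (\<lambda>a x. x \<in> S a) (a # as) xs. \<chi> (ws @ map2 g (a # as) xs))"
    unfolding sum.cartesian_product
    by (rule sum.reindex_bij_witness[where j = "\<lambda>(x, xs). x # xs" and i = "\<lambda>xs. (hd xs, tl xs)"])
       (auto simp: list_all2_Cons1)
  finally show ?case .
next
  case Nil
  have "Collect (list_all2 (\<lambda>a x. x \<in> S a) []) = {[]}" by auto
  then show ?case by simp
qed

lemma multiadditive_zero:
  assumes "multiadditive \<chi>" "0 \<in> set xs"
  shows "\<chi> xs = 0"
proof -
  obtain as bs where "xs = as @ 0 # bs" using assms(2) by (meson split_list)
  then show ?thesis using assms(1) additive.zero unfolding multiadditive_def by blast
qed

text \<open>Cutting \<open>map f us\<close> is cutting \<open>us\<close> at the same places. For the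
  harder inclusion the first block is peeled off and lifted to the prefix of \<open>us\<close> of
  the same length.\<close>

lemma splits_map: "splits (map f us) = map (map f) ` splits us"
proof
  show "map (map f) ` splits us \<subseteq> splits (map f us)"
    by (auto simp: splits_def map_concat)
  show "splits (map f us) \<subseteq> map (map f) ` splits us"
  proof
    fix yss assume "yss \<in> splits (map f us)"
    then show "yss \<in> map (map f) ` splits us"
    proof (induction yss arbitrary: us)
      case (Cons ys yss)
      have us: "us = take (length ys) us @ drop (length ys) us" by simp
      have "ys @ concat yss = map f us" "ys \<noteq> []" "[] \<notin> set yss"
        using Cons.prems by (auto simp: splits_def)
      then have ys: "ys = map f (take (length ys) us)" "concat yss = map f (drop (length ys) us)"
        by (metis append_eq_conv_conj take_map, metis append_eq_conv_conj drop_map)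
      obtain xss where xss: "xss \<in> splits (drop (length ys) us)" "yss = map (map f) xss"
        using Cons.IH[of "drop (length ys) us"] ys \<open>[] \<notin> set yss\<close> by (auto simp: splits_def)
      have "take (length ys) us # xss \<in> splits us"
        using xss \<open>ys \<noteq> []\<close> ys by (auto simp: splits_def)
      then show ?case using xss ys(1) by (metis image_eqI list.simps(9))
    qed (auto simp: splits_def)
  qed
qed

text \<open>Serves to recover a decomposition from data that retain only block lengths: its image
  under a map, or the leaf counts of a forest.\<close>

lemma eq_if_concat_eq_and_lengths_eq:
  "concat xss = concat yss \<Longrightarrow> map length xss = map length yss \<Longrightarrow> xss = yss"
proof (induction xss arbitrary: yss)
  case (Cons xs xss)
  then show ?case by (cases yss) auto
qed simp

text \<open>This holds even for non-injective \<open>f\<close>, since block lengths survive the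
  mapping.\<close>

lemma inj_on_map_map_splits: "inj_on (map (map f)) (splits us)"
proof (rule inj_onI)
  fix xss yss assume "xss \<in> splits us" "yss \<in> splits us" "map (map f) xss = map (map f) yss"
  then have "concat xss = concat yss" "map length xss = map length yss"
    by (auto simp: splits_def) (metis (no_types, lifting) length_map list.map_comp comp_apply map_eq_conv)
  then show "xss = yss" by (rule eq_if_concat_eq_and_lengths_eq)
qed

lemma concat_concat: "concat (concat xsss) = concat (map concat xsss)"
  by (induction xsss) auto

lemma nc_comp_assoc:
  fixes \<phi> :: "'a list \<Rightarrow> 'b::ab_group_add" and \<psi> :: "'b list \<Rightarrow> 'c::ab_group_add"
    and \<chi> :: "'c list \<Rightarrow> 'd::ab_group_add"
  assumes "multiadditive \<chi>" "\<chi> [] = 0" "\<psi> [] = 0"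
  shows "nc_comp (nc_comp \<chi> \<psi>) \<phi> = nc_comp \<chi> (nc_comp \<psi> \<phi>)"
proof
  fix us :: "'a list"
  text \<open>
    Both sides are sums over the two-level decompositions \<open>xsss\<close> of \<open>us\<close>: the left one groups them
    by their fine blocks \<open>concat xsss\<close>, the right one by their coarse blocks \<open>map concat xsss\<close>.
  \<close>
  have "nc_comp (nc_comp \<chi> \<psi>) \<phi> us = (\<Sum>xss\<in>splits us. nc_comp \<chi> \<psi> (map \<phi> xss))"
    by (rule nc_comp_eq_sum_splits) (simp add: nc_comp_def)
  \<comment> \<open>Decompositions of \<open>map \<phi> xss\<close> are pulled back to
    decompositions of \<open>xss\<close>, so that the fine blocks themselves remain
    available.\<close>
  also have "\<dots> = (\<Sum>xss\<in>splits us. \<Sum>xsss\<in>splits xss. \<chi> (map (\<lambda>xss. \<psi> (map \<phi> xss)) xsss))"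
    by (simp add: nc_comp_eq_sum_splits assms splits_map sum.reindex inj_on_map_map_splits comp_def)
  also have "\<dots> = (\<Sum>(xss, xsss)\<in>Sigma (splits us) splits. \<chi> (map (\<lambda>xss. \<psi> (map \<phi> xss)) xsss))"
    by (rule sum.Sigma) (auto simp: finite_splits)
  also have "\<dots> = (\<Sum>(zss, xsss)\<in>(SIGMA zss:splits us. {xsss. list_all2 (\<lambda>zs xss. xss \<in> splits zs) zss xsss}).
        \<chi> (map (\<lambda>xss. \<psi> (map \<phi> xss)) xsss))"
  \<comment> \<open>On either side the first component is determined by \<open>xsss\<close>, so the
    bijection keeps \<open>xsss\<close> and exchanges the fine blocks for the coarse ones.\<close>
  proof (rule sum.reindex_bij_witness[where j = "\<lambda>(xss, xsss). (map concat xsss, xsss)"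
        and i = "\<lambda>(zss, xsss). (concat xsss, xsss)"], goal_cases)
    case (2 p)
    then obtain xss xsss where p: "p = (xss, xsss)" and *: "concat xss = us" "[] \<notin> set xss"
        "concat xsss = xss" "[] \<notin> set xsss"
      by (auto simp: splits_def)
    have "concat (map concat xsss) = us" using * by (metis concat_concat)
    moreover have "[] \<notin> set (map concat xsss)" using * by (auto, metis all_not_in_conv list.set_sel(1) set_empty)
    ultimately show ?case using p * by (auto simp: splits_def list_all2_map1 list_all2_same)
  next
    case (3 p)
    then show ?case by (auto simp: splits_def list_all2_conv_all_nth intro!: nth_equalityI)
  next
    case (4 p)
    then obtain zss xsss where p: "p = (zss, xsss)" and zss: "zss \<in> splits us"
        and all: "list_all2 (\<lambda>zs xss. xss \<in> splits zs) zss xsss" by auto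
    have eq: "map concat xsss = zss"
      using all by (auto simp: splits_def list_all2_conv_all_nth intro!: nth_equalityI)
    have ne: "[] \<notin> set xss" if "xss \<in> set xsss" for xss
      using all that by (auto simp: splits_def list_all2_conv_all_nth in_set_conv_nth)
    have "concat (concat xsss) = us" using zss eq by (auto simp: splits_def concat_concat)
    moreover have "[] \<notin> set xsss"
      using zss unfolding splits_def eq[symmetric] by force
    ultimately show ?case using p ne by (auto simp: splits_def)
  qed (auto simp: splits_def)
  also have "\<dots> = (\<Sum>zss\<in>splits us. \<Sum>xsss | list_all2 (\<lambda>zs xss. xss \<in> splits zs) zss xsss.
        \<chi> (map (\<lambda>xss. \<psi> (map \<phi> xss)) xsss))"
  proof (rule sum.Sigma[symmetric])
    show "\<forall>zss\<in>splits us. finite {xsss. list_all2 (\<lambda>zs xss. xss \<in> splits zs) zss xsss}"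
    proof
      fix zss :: "'a list list"
      have "finite {xsss. set xsss \<subseteq> (\<Union>zs\<in>set zss. splits zs) \<and> length xsss = length zss}"
        by (intro finite_lists_length_eq) (auto simp: finite_splits)
      then show "finite {xsss. list_all2 (\<lambda>zs xss. xss \<in> splits zs) zss xsss}"
        by (rule finite_subset[rotated]) (fastforce simp: list_all2_conv_all_nth in_set_conv_nth)
    qed
  qed (rule finite_splits)
  \<comment> \<open>By distributivity of \<open>\<chi>\<close>, choosing a fine decomposition inside
    each coarse block expands the inner composites.\<close>
  also have "\<dots> = (\<Sum>zss\<in>splits us. \<chi> (map (nc_comp \<psi> \<phi>) zss))"
  proof (rule sum.cong)
    fix zss :: "'a list list"
    have *: "map2 (\<lambda>zs. g) zss xsss = map g xsss" if "length zss = length xsss" for g :: "'a list list \<Rightarrow> 'c" and xsss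
      using that by (induction zss xsss rule: list_induct2) auto
    have "\<chi> (map (nc_comp \<psi> \<phi>) zss) = \<chi> ([] @ map (\<lambda>zs. \<Sum>xss\<in>splits zs. \<psi> (map \<phi> xss)) zss)"
      by (simp add: nc_comp_eq_sum_splits assms cong: map_cong)
    also have "\<dots> = (\<Sum>xsss | list_all2 (\<lambda>zs xss. xss \<in> splits zs) zss xsss. \<chi> (map (\<lambda>xss. \<psi> (map \<phi> xss)) xsss))"
      by (subst multiadditive_sum[OF assms(1)])
         (auto simp: finite_splits * list_all2_lengthD intro!: sum.cong)
    finally show "(\<Sum>xsss | list_all2 (\<lambda>zs xss. xss \<in> splits zs) zss xsss. \<chi> (map (\<lambda>xss. \<psi> (map \<phi> xss)) xsss)) =
       \<chi> (map (nc_comp \<psi> \<phi>) zss)" by simp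
  qed simp
  also have "\<dots> = nc_comp \<chi> (nc_comp \<psi> \<phi>) us"
    by (rule nc_comp_eq_sum_splits[symmetric]) (rule assms)
  finally show "nc_comp (nc_comp \<chi> \<psi>) \<phi> us = nc_comp \<chi> (nc_comp \<psi> \<phi>) us" .
qed

section \<open>The identity series as a two-sided unit\<close>

lemma map_singleton_in_splits: "map (\<lambda>u. [u]) us \<in> splits us"
  by (auto simp: splits_def)

lemma singleton_in_splits: "us \<noteq> [] \<Longrightarrow> [us] \<in> splits us"
  by (auto simp: splits_def)

text \<open>On a nonempty list \<open>nc_id\<close> kills every decomposition except the one with a
  single block.\<close>

lemma nc_comp_id_left:
  assumes "\<phi> [] = 0"
  shows "nc_comp nc_id \<phi> = \<phi>"
proof
  fix us
  show "nc_comp nc_id \<phi> us = \<phi> us"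
  proof (cases "us = []")
    case True
    then show ?thesis using assms by (simp add: nc_comp_def)
  next
    case False
    have "xss = [us]" if "xss \<in> splits us" "length xss = 1" for xss
      using that by (auto simp: splits_def length_Suc_conv)
    then have "(\<Sum>xss\<in>splits us. nc_id (map \<phi> xss)) = (\<Sum>xss\<in>{[us]}. nc_id (map \<phi> xss))"
      using False by (intro sum.mono_neutral_right)
        (auto simp: finite_splits singleton_in_splits nc_id_def)
    then show ?thesis by (subst nc_comp_eq_sum_splits) (auto simp: nc_id_def)
  qed
qed

text \<open>Only the decomposition into singletons survives: any other has a block that
  \<open>nc_id\<close> sends to 0, and a multiadditive map vanishes once an argument is 0.\<close>

lemma nc_comp_id_right:
  fixes \<psi> :: "'a::ab_group_add list \<Rightarrow> 'b::ab_group_add"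
  assumes "multiadditive \<psi>" "\<psi> [] = 0"
  shows "nc_comp \<psi> nc_id = \<psi>"
proof
  fix us :: "'a list"
  have singletons: "xss = map (\<lambda>u. [u]) (concat xss)" if "\<forall>xs\<in>set xss. length xs = 1" for xss :: "'a list list"
    using that by (induction xss) (auto simp: length_Suc_conv)
  have "\<exists>xs\<in>set xss. length xs \<noteq> 1" if "xss \<in> splits us" "xss \<noteq> map (\<lambda>u. [u]) us" for xss
    using that singletons[of xss] by (auto simp: splits_def)
  then have "0 \<in> set (map nc_id xss)" if "xss \<in> splits us" "xss \<noteq> map (\<lambda>u. [u]) us" for xss
    using that by (force simp: nc_id_def image_iff)
  then have "(\<Sum>xss\<in>splits us. \<psi> (map nc_id xss)) = (\<Sum>xss\<in>{map (\<lambda>u. [u]) us}. \<psi> (map nc_id xss))"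
    by (intro sum.mono_neutral_right)
      (auto simp: finite_splits map_singleton_in_splits intro: multiadditive_zero[OF assms(1)])
  then show "nc_comp \<psi> nc_id us = \<psi> us"
    by (simp add: nc_comp_eq_sum_splits assms comp_def nc_id_def)
qed


section \<open>Sums over reduced trees\<close>

abbreviation reduced :: "plane_tree \<Rightarrow> bool" where
  "reduced T \<equiv> \<forall>p\<in>vertices T. valency T p \<ge> 3"

definition reduced_trees :: "nat \<Rightarrow> plane_tree set" where
  "reduced_trees n = {T. num_leaves T = n \<and> reduced T}"

text \<open>No signs appear here: they will come from taking a negated series for
  \<open>\<theta>\<close>, which yields one factor -1 per vertex.\<close>

definition tree_sum :: "('v list \<Rightarrow> 'v) \<Rightarrow> 'v list \<Rightarrow> 'v::ab_group_add" where
  "tree_sum \<theta> us = (\<Sum>T\<in>reduced_trees (length us). tree_map \<theta> T us)"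

text \<open>Valency counts the outgoing edge too, so valency at least 3 means at least two
  subtrees.\<close>

lemma reduced_Vertex: "reduced (Vertex ts) \<longleftrightarrow> length ts \<ge> 2 \<and> (\<forall>t\<in>set ts. reduced t)"
  by (auto simp: all_set_conv_all_nth)

text \<open>Reducedness excludes \<open>Vertex []\<close>, the way a tree could end without a
  leaf.\<close>

lemma num_leaves_pos: "reduced T \<Longrightarrow> num_leaves T \<ge> 1"
proof (induction T)
  case (Vertex ts)
  have ts: "length ts \<ge> 2" "\<forall>t\<in>set ts. reduced t"
    using Vertex.prems reduced_Vertex[of ts] by blast+
  then obtain t where t: "t \<in> set ts" by (cases ts) auto
  then have "num_leaves t \<le> num_leaves (Vertex ts)" by (simp add: member_le_sum_list)
  then show ?case using Vertex.IH t ts(2) by force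
qed simp

text \<open>At a root vertex there are at least two subtrees, each with a leaf. Hence there are at
  most \<open>n\<close> of them and each has fewer than \<open>n\<close> leaves, which permits
  strong induction.\<close>

lemma finite_reduced_trees: "finite (reduced_trees n)"
proof (induction n rule: less_induct)
  case (less n)
  have "T \<in> insert Leaf (Vertex ` {ts. set ts \<subseteq> (\<Union>m<n. reduced_trees m) \<and> length ts \<le> n})"
    if "T \<in> reduced_trees n" for T
  proof (cases T)
    case (Vertex ts)
    have n: "sum_list (map num_leaves ts) = n" and ts: "length ts \<ge> 2" "\<forall>t\<in>set ts. reduced t"
      using that Vertex reduced_Vertex[of ts] by (simp_all add: reduced_trees_def)
    have len: "length us \<le> sum_list (map num_leaves us)" if "set us \<subseteq> set ts" for us
      using that
    proof (induction us)
      case (Cons u us)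
      then show ?case using num_leaves_pos[of u] ts(2) by fastforce
    qed simp
    have "t \<in> (\<Union>m<n. reduced_trees m)" if t: "t \<in> set ts" for t
    proof -
      obtain as bs where ab: "ts = as @ t # bs" using t by (meson split_list)
      have "length as \<le> sum_list (map num_leaves as)" "length bs \<le> sum_list (map num_leaves bs)"
        using ab by (auto intro!: len)
      moreover have "n = sum_list (map num_leaves as) + num_leaves t + sum_list (map num_leaves bs)"
        using n ab by simp
      moreover have "length as + length bs \<ge> 1" using ts(1) ab by simp
      ultimately have "num_leaves t < n" by linarith
      then show ?thesis using t ts(2) by (auto simp: reduced_trees_def)
    qed
    then show ?thesis using Vertex n len[of ts] by auto
  qed simp
  moreover have "finite {ts. set ts \<subseteq> (\<Union>m<n. reduced_trees m) \<and> length ts \<le> n}"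
    using less by (intro finite_lists_length_le) auto
  ultimately show ?case by (meson finite_imageI finite_insert finite_subset subsetI)
qed

lemma forest_map_concat:
  "list_all2 (\<lambda>xs t. num_leaves t = length xs) xss ts \<Longrightarrow>
    forest_map \<theta> ts (concat xss) = map2 (\<lambda>xs t. tree_map \<theta> t xs) xss ts"
  by (induction rule: list_all2_induct) auto

text \<open>Recovers the blocks in which \<open>forest_map\<close> deals out its arguments; this
  gives surjectivity when trees are cut at the root.\<close>

lemma ex_blocks_of_forest:
  "sum_list (map num_leaves ts) = length us \<Longrightarrow>
    \<exists>xss. concat xss = us \<and> list_all2 (\<lambda>xs t. num_leaves t = length xs) xss ts"
proof (induction ts arbitrary: us)
  case (Cons t ts)
  have "sum_list (map num_leaves ts) = length (drop (num_leaves t) us)" using Cons.prems by simp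
  from Cons.IH[OF this] obtain xss where "concat xss = drop (num_leaves t) us"
      "list_all2 (\<lambda>xs t. num_leaves t = length xs) xss ts"
    by blast
  then show ?case using Cons.prems
    by (intro exI[of _ "take (num_leaves t) us # xss"]) auto
qed simp

lemma num_leaves_forest:
  "list_all2 (\<lambda>xs t. num_leaves t = length xs) xss ts \<Longrightarrow>
    sum_list (map num_leaves ts) = length (concat xss)"
  by (induction rule: list_all2_induct) auto

text \<open>Cut at the root vertex. The tree \<open>Leaf\<close> contributes \<open>nc_id\<close>;
  any other reduced tree amounts to a decomposition into at least two blocks with a reduced tree on
  each block, and multiadditivity gathers these choices into values of
  \<open>tree_sum\<close>.\<close>

lemma tree_sum_rec:
  assumes "multiadditive \<theta>"
  shows "tree_sum \<theta> us =
    nc_id us + (\<Sum>xss | xss \<in> splits us \<and> length xss \<ge> 2. \<theta> (map (tree_sum \<theta>) xss))"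
proof -
  define F where "F xss = {ts. list_all2 (\<lambda>xs t. t \<in> reduced_trees (length xs)) xss ts}"
    for xss :: "'a list list"
  define P where "P = (SIGMA xss:{xss. xss \<in> splits us \<and> length xss \<ge> 2}. F xss)"
  have fin: "finite {xss. xss \<in> splits us \<and> length xss \<ge> 2}"
    by (rule finite_subset[OF _ finite_splits[of us]]) auto
  have leaves: "list_all2 (\<lambda>xs t. num_leaves t = length xs) xss ts" if "ts \<in> F xss" for xss ts
    using that unfolding F_def by (auto elim!: list_all2_mono simp: reduced_trees_def)
  have finF: "finite (F xss)" for xss
  proof (rule finite_subset)
    show "F xss \<subseteq> {ts. set ts \<subseteq> (\<Union>xs\<in>set xss. reduced_trees (length xs)) \<and> length ts = length xss}"
      by (fastforce simp: F_def list_all2_conv_all_nth in_set_conv_nth)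
    show "finite {ts. set ts \<subseteq> (\<Union>xs\<in>set xss. reduced_trees (length xs)) \<and> length ts = length xss}"
      by (intro finite_lists_length_eq) (auto simp: finite_reduced_trees)
  qed
  \<comment> \<open>The leaf counts of the subtrees are the block lengths, so the forest determines
    the decomposition.\<close>
  have inj: "inj_on (\<lambda>(xss, ts). Vertex ts) P"
  proof (rule inj_onI, clarsimp simp: P_def)
    fix xss yss ts
    assume *: "xss \<in> splits us" "yss \<in> splits us" "ts \<in> F xss" "ts \<in> F yss"
    have "map length zss = map num_leaves ts" if "ts \<in> F zss" for zss
      using leaves[OF that] by (auto simp: list_all2_conv_all_nth intro!: nth_equalityI)
    then have "map length xss = map length yss" using * by metis
    then show "xss = yss"
      using * by (intro eq_if_concat_eq_and_lengths_eq) (auto simp: splits_def)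
  qed
  have image: "(\<lambda>(xss, ts). Vertex ts) ` P = reduced_trees (length us) - {Leaf}"
  proof (intro equalityI subsetI)
    fix T assume "T \<in> (\<lambda>(xss, ts). Vertex ts) ` P"
    then obtain xss ts where T: "T = Vertex ts" and xss: "xss \<in> splits us" "length xss \<ge> 2" "ts \<in> F xss"
      by (auto simp: P_def)
    have "reduced t" if "t \<in> set ts" for t
      using xss(3) that by (auto simp: F_def list_all2_conv_all_nth in_set_conv_nth reduced_trees_def)
    moreover have "length ts \<ge> 2" using xss by (auto simp: F_def dest: list_all2_lengthD)
    moreover have "num_leaves T = length us"
      using num_leaves_forest[OF leaves[OF xss(3)]] xss(1) T by (simp add: splits_def)
    ultimately show "T \<in> reduced_trees (length us) - {Leaf}"
      using reduced_Vertex[of ts] T by (simp add: reduced_trees_def)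
  next
    fix T assume T: "T \<in> reduced_trees (length us) - {Leaf}"
    then obtain ts where ts: "T = Vertex ts" by (cases T) auto
    have red: "length ts \<ge> 2" "\<forall>t\<in>set ts. reduced t"
      using T reduced_Vertex[of ts] unfolding ts by (simp_all add: reduced_trees_def)
    obtain xss where xss: "concat xss = us" "list_all2 (\<lambda>xs t. num_leaves t = length xs) xss ts"
      using ex_blocks_of_forest[of ts us] T ts by (auto simp: reduced_trees_def)
    have "ts \<in> F xss"
      using xss(2) red(2) by (auto simp: F_def list_all2_conv_all_nth reduced_trees_def)
    \<comment> \<open>An empty block would belong to a reduced subtree without leaves.\<close>
    moreover have "[] \<notin> set xss"
    proof
      assume "[] \<in> set xss"
      then obtain t where "t \<in> set ts" "num_leaves t = 0"
        using xss(2) by (fastforce simp: list_all2_conv_all_nth in_set_conv_nth)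
      then show False using num_leaves_pos[of t] red(2) by auto
    qed
    ultimately have "(xss, ts) \<in> P"
      using xss red(1) by (auto simp: P_def splits_def dest: list_all2_lengthD)
    then show "T \<in> (\<lambda>(xss, ts). Vertex ts) ` P" using ts by force
  qed
  have vertex: "\<theta> (map2 (\<lambda>xs t. tree_map \<theta> t xs) xss ts) = tree_map \<theta> (Vertex ts) us"
    if "xss \<in> splits us" "ts \<in> F xss" for xss ts
    using forest_map_concat[OF leaves[OF that(2)]] that(1) by (simp add: splits_def)
  have "(\<Sum>xss | xss \<in> splits us \<and> length xss \<ge> 2. \<theta> (map (tree_sum \<theta>) xss)) =
      (\<Sum>xss | xss \<in> splits us \<and> length xss \<ge> 2. \<Sum>ts\<in>F xss. tree_map \<theta> (Vertex ts) us)"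
  proof (rule sum.cong)
    fix xss assume xss: "xss \<in> {xss. xss \<in> splits us \<and> length xss \<ge> 2}"
    have "\<theta> (map (tree_sum \<theta>) xss) =
        \<theta> ([] @ map (\<lambda>xs. \<Sum>T\<in>reduced_trees (length xs). tree_map \<theta> T xs) xss)"
      by (simp add: tree_sum_def cong: map_cong)
    also have "\<dots> = (\<Sum>ts\<in>F xss. \<theta> ([] @ map2 (\<lambda>xs t. tree_map \<theta> t xs) xss ts))"
      unfolding F_def by (rule multiadditive_sum[OF assms]) (rule finite_reduced_trees)
    also have "\<dots> = (\<Sum>ts\<in>F xss. tree_map \<theta> (Vertex ts) us)"
      using xss vertex by (intro sum.cong) auto
    finally show "\<theta> (map (tree_sum \<theta>) xss) = (\<Sum>ts\<in>F xss. tree_map \<theta> (Vertex ts) us)" .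
  qed simp
  also have "\<dots> = (\<Sum>(xss, ts)\<in>P. tree_map \<theta> (Vertex ts) us)"
    unfolding P_def using fin finF by (intro sum.Sigma) auto
  also have "\<dots> = (\<Sum>T\<in>(\<lambda>(xss, ts). Vertex ts) ` P. tree_map \<theta> T us)"
    by (subst sum.reindex[OF inj]) (auto simp: comp_def case_prod_unfold)
  also have "\<dots> = (\<Sum>T\<in>reduced_trees (length us) - {Leaf}. tree_map \<theta> T us)"
    by (simp only: image)
  finally have *: "(\<Sum>xss | xss \<in> splits us \<and> length xss \<ge> 2. \<theta> (map (tree_sum \<theta>) xss)) = \<dots>" .
  have "tree_sum \<theta> us = nc_id us + (\<Sum>T\<in>reduced_trees (length us) - {Leaf}. tree_map \<theta> T us)"
  proof (cases "length us = 1")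
    case True
    then have "Leaf \<in> reduced_trees (length us)" by (simp add: reduced_trees_def)
    then show ?thesis
      unfolding tree_sum_def by (subst sum.remove[of _ Leaf]) (auto simp: finite_reduced_trees nc_id_def True)
  next
    case False
    then have "reduced_trees (length us) - {Leaf} = reduced_trees (length us)"
      by (auto simp: reduced_trees_def)
    then show ?thesis using False by (simp add: tree_sum_def nc_id_def)
  qed
  then show ?thesis using * by simp
qed

text \<open>Since \<open>\<phi>\<close> is the identity in degree 1, the one-block term of the
  composite is the tree sum itself. By the root recursion for the negated series, the terms with
  more blocks are exactly what completes it to \<open>nc_id\<close>.\<close>

lemma nc_comp_tree_sum_uminus:
  assumes "multiadditive \<phi>" "\<phi> [] = 0" "\<And>v. \<phi> [v] = v"
  shows "nc_comp \<phi> (tree_sum (\<lambda>vs. - \<phi> vs)) = nc_id"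
proof
  fix us
  define \<psi> where "\<psi> = tree_sum (\<lambda>vs. - \<phi> vs)"
  have "multiadditive (\<lambda>vs. - \<phi> vs)"
    using assms(1) by (simp add: multiadditive_def additive_def)
  from tree_sum_rec[OF this, of us]
  have rec: "\<psi> us + (\<Sum>xss | xss \<in> splits us \<and> length xss \<ge> 2. \<phi> (map \<psi> xss)) = nc_id us"
    by (simp add: \<psi>_def sum_negf)
  show "nc_comp \<phi> (tree_sum (\<lambda>vs. - \<phi> vs)) us = nc_id us"
  proof (cases "us = []")
    case True
    then show ?thesis by (simp add: nc_comp_def nc_id_def)
  next
    case False
    \<comment> \<open>The rule \<open>remdups_adj.cases\<close> only provides the case split into
      no, one, or at least two blocks.\<close>
    have "xss = [us] \<or> length xss \<ge> 2" if "xss \<in> splits us" for xss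
      using that False by (cases xss rule: remdups_adj.cases) (auto simp: splits_def)
    then have "splits us = insert [us] {xss. xss \<in> splits us \<and> length xss \<ge> 2}"
      using singleton_in_splits[OF False] by auto
    then have "(\<Sum>xss\<in>splits us. \<phi> (map \<psi> xss)) =
        (\<Sum>xss\<in>insert [us] {xss. xss \<in> splits us \<and> length xss \<ge> 2}. \<phi> (map \<psi> xss))"
      by simp
    also have "\<dots> = \<psi> us + (\<Sum>xss | xss \<in> splits us \<and> length xss \<ge> 2. \<phi> (map \<psi> xss))"
      using finite_splits[of us] by (subst sum.insert) (auto simp: assms(3))
    finally show ?thesis
      using rec assms(2) by (simp add: nc_comp_eq_sum_splits \<psi>_def)
  qed
qed

lemma tree_sum_Nil: "tree_sum \<theta> [] = 0"
proof -
  have "reduced_trees 0 = {}" using num_leaves_pos by (force simp: reduced_trees_def)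
  then show ?thesis by (simp add: tree_sum_def)
qed

text \<open>One argument cannot be cut into two nonempty blocks, so only \<open>nc_id\<close>
  remains in the recursion. This lets the inversion be applied again to its own result.\<close>

lemma tree_sum_singleton: "multiadditive \<theta> \<Longrightarrow> tree_sum \<theta> [v] = v"
proof -
  assume "multiadditive \<theta>"
  have "\<not> length xss \<ge> 2" if "xss \<in> splits [v]" for xss
    using that length_le_length_concat[of xss] by (auto simp: splits_def)
  then have none: "{xss. xss \<in> splits [v] \<and> length xss \<ge> 2} = {}" by blast
  show ?thesis
    by (subst tree_sum_rec[OF \<open>multiadditive \<theta>\<close>], subst none) (simp add: nc_id_def)
qed

section \<open>Linearity and signs\<close>

lemma nc_series_multiadditive: "nc_series sU sV \<phi> \<Longrightarrow> multiadditive \<phi>"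
  by (simp add: nc_series_def multiadditive_def additive_def Vector_Spaces.linear_iff)

text \<open>A single argument enters exactly one subtree; the outputs \<open>ps\<close> and
  \<open>qs\<close> of the others, and the subtree itself, are independent of
  \<open>u\<close>.\<close>

lemma forest_map_isolate_argument:
  "length xs + 1 + length ys = sum_list (map num_leaves ts) \<Longrightarrow>
    \<exists>ps t qs xs' ys'. t \<in> set ts \<and> length xs' + 1 + length ys' = num_leaves t \<and>
      (\<forall>u. forest_map \<theta> ts (xs @ u # ys) = ps @ tree_map \<theta> t (xs' @ u # ys') # qs)"
proof (induction ts arbitrary: xs)
  case (Cons t ts)
  show ?case
  proof (cases "num_leaves t \<le> length xs")
    case True
    then have "length (drop (num_leaves t) xs) + 1 + length ys = sum_list (map num_leaves ts)"
      using Cons.prems by simp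
    from Cons.IH[OF this] obtain ps t' qs xs' ys' where
      "t' \<in> set ts" "length xs' + 1 + length ys' = num_leaves t'"
      "\<And>u. forest_map \<theta> ts (drop (num_leaves t) xs @ u # ys) = ps @ tree_map \<theta> t' (xs' @ u # ys') # qs"
      by blast
    then show ?thesis using True
      by (intro exI[of _ "tree_map \<theta> t (take (num_leaves t) xs) # ps"] exI[of _ t'] exI[of _ qs]
          exI[of _ xs'] exI[of _ ys']) auto
  next
    case False
    \<comment> \<open>The first tree receives \<open>u\<close>; \<open>m\<close> is the number of
      arguments it still takes from \<open>ys\<close>.\<close>
    define m where "m = num_leaves t - length xs - 1"
    have m: "num_leaves t = length xs + Suc m" using False by (simp add: m_def)
    then show ?thesis using Cons.prems
      by (intro exI[of _ "[]"] exI[of _ t] exI[of _ "forest_map \<theta> ts (drop m ys)"]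
          exI[of _ xs] exI[of _ "take m ys"]) auto
  qed
qed simp

lemma finite_vertices: "finite (vertices T)"
  by (induction T) auto

text \<open>Paths into different subtrees differ in their first index, and the root is the empty
  path, so the union is disjoint.\<close>

lemma card_vertices_Vertex:
  "card (vertices (Vertex ts)) = Suc (sum_list (map (\<lambda>t. card (vertices t)) ts))"
proof -
  have "card (\<Union>i<length ts. (#) i ` vertices (ts ! i)) = (\<Sum>i<length ts. card ((#) i ` vertices (ts ! i)))"
    by (rule card_UN_disjoint) (auto simp: finite_vertices)
  then show ?thesis
    by (simp add: card_image finite_vertices card_insert_if sum_list_sum_nth atLeast0LessThan image_iff)
qed

locale complex_vector_space = vector_space scale
  for scale :: "complex \<Rightarrow> 'v::ab_group_add \<Rightarrow> 'v"
begin

text \<open>The varying argument passes through one subtree, linear by induction, and then through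
  one slot of \<open>\<theta>\<close>.\<close>

lemma linear_tree_map:
  assumes "nc_series scale scale \<theta>"
  shows "length xs + 1 + length ys = num_leaves T \<Longrightarrow>
    Vector_Spaces.linear scale scale (\<lambda>u. tree_map \<theta> T (xs @ u # ys))"
proof (induction T arbitrary: xs ys)
  case Leaf
  then show ?case using linear_ident by simp
next
  case (Vertex ts)
  from Vertex.prems have "length xs + 1 + length ys = sum_list (map num_leaves ts)" by simp
  from forest_map_isolate_argument[OF this, of \<theta>] obtain ps t qs xs' ys' where
    t: "t \<in> set ts" "length xs' + 1 + length ys' = num_leaves t"
    and eq: "\<And>u. forest_map \<theta> ts (xs @ u # ys) = ps @ tree_map \<theta> t (xs' @ u # ys') # qs"
    by blast
  have "\<forall>xs ys. Vector_Spaces.linear scale scale (\<lambda>u. \<theta> (xs @ u # ys))"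
    using assms by (simp add: nc_series_def)
  from this[rule_format, of ps qs] have "Vector_Spaces.linear scale scale
      ((\<lambda>u. \<theta> (ps @ u # qs)) \<circ> (\<lambda>u. tree_map \<theta> t (xs' @ u # ys')))"
    by (rule Vector_Spaces.linear_compose[OF Vertex.IH[OF t]])
  then show ?case by (simp add: eq comp_def)
qed

lemma nc_series_tree_sum:
  assumes "nc_series scale scale \<theta>"
  shows "nc_series scale scale (tree_sum \<theta>)"
proof -
  interpret vector_space_pair scale scale ..
  show ?thesis
    unfolding nc_series_def
    using linear_tree_map[OF assms]
    by (auto simp: tree_sum_Nil) (auto simp: tree_sum_def reduced_trees_def intro!: linear_compose_sum)
qed

lemma nc_series_uminus:
  assumes "nc_series scale scale \<phi>"
  shows "nc_series scale scale (\<lambda>vs. - \<phi> vs)"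
proof -
  interpret vector_space_pair scale scale ..
  show ?thesis using assms by (simp add: nc_series_def linear_compose_neg)
qed

text \<open>Used to pull the signs of all subtrees out of the operation at their common root;
  \<open>ws\<close> holds the arguments already treated.\<close>

lemma nc_series_scale_args:
  assumes "nc_series scale scale \<phi>" "length cs = length vs"
  shows "\<phi> (ws @ map2 scale cs vs) = scale (prod_list cs) (\<phi> (ws @ vs))"
  using assms(2)
proof (induction cs vs arbitrary: ws rule: list_induct2)
  case (Cons c cs v vs)
  have "\<phi> (ws @ map2 scale (c # cs) (v # vs)) = scale c (\<phi> (ws @ v # map2 scale cs vs))"
    using assms(1) by (simp add: nc_series_def Vector_Spaces.linear_iff)
  then show ?case using Cons.IH[of "ws @ [v]"] by simp
qed simp

lemma tree_map_uminus:
  assumes "nc_series scale scale \<phi>"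
  shows "tree_map (\<lambda>vs. - \<phi> vs) T us = scale ((-1) ^ card (vertices T)) (tree_map \<phi> T us)"
proof (induction T arbitrary: us)
  case Leaf
  show ?case by simp
next
  case (Vertex ts)
  define sign :: "plane_tree \<Rightarrow> complex" where "sign t = (-1) ^ card (vertices t)" for t
  \<comment> \<open>Stated for any list \<open>ss\<close> of subtrees so that an inner induction can
    shorten it while the hypothesis on subtrees of \<open>ts\<close> stays usable.\<close>
  have "forest_map (\<lambda>vs. - \<phi> vs) ss us = map2 scale (map sign ss) (forest_map \<phi> ss us)"
    if "set ss \<subseteq> set ts" for ss
    using that by (induction ss arbitrary: us) (auto simp: Vertex sign_def)
  moreover have "length (forest_map \<phi> ss us) = length ss" for ss
    by (induction ss arbitrary: us) auto
  moreover have "prod_list (map sign ss) = (-1) ^ sum_list (map (\<lambda>t. card (vertices t)) ss)" for ss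
    by (induction ss) (auto simp: sign_def power_add)
  ultimately show ?case
    using nc_series_scale_args[OF assms, of "map sign ts" "forest_map \<phi> ts us" "[]"]
    by (simp add: card_vertices_Vertex del: vertices.simps)
qed

end

section \<open>Existence, uniqueness and formula for the inverse\<close>

theorem theorem11p3:
  fixes scale :: "complex \<Rightarrow> 'v::ab_group_add \<Rightarrow> 'v"
    and \<phi> :: "'v list \<Rightarrow> 'v"
  assumes "vector_space scale"
    and "nc_series scale scale \<phi>"
    and "\<And>v. \<phi> [v] = v"
  shows "nc_invertible scale scale \<phi> \<and>
    (\<forall>v. nc_inv scale scale \<phi> [v] = v) \<and>
    (\<forall>vs. length vs > 1 \<longrightarrow>
      nc_inv scale scale \<phi> vs =
        (\<Sum>T | num_leaves T = length vs \<and> (\<forall>p\<in>vertices T. valency T p \<ge> 3).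
          scale ((-1) ^ card (vertices T)) (tree_map \<phi> T vs)))"
proof -
  interpret complex_vector_space scale
    using assms(1) by (simp add: complex_vector_space_def)
  define \<psi> where "\<psi> = tree_sum (\<lambda>vs. - \<phi> vs)"
  define \<chi> where "\<chi> = tree_sum (\<lambda>vs. - \<psi> vs)"
  have series: "nc_series scale scale \<psi>"
    unfolding \<psi>_def by (intro nc_series_tree_sum nc_series_uminus assms(2))
  have series': "nc_series scale scale \<chi>"
    unfolding \<chi>_def by (intro nc_series_tree_sum nc_series_uminus series)
  note add = nc_series_multiadditive
  have Nil: "\<eta> [] = 0" if "nc_series scale scale \<eta>" for \<eta>
    using that by (simp add: nc_series_def)
  have \<psi>1: "\<psi> [v] = v" for v
    unfolding \<psi>_def by (intro tree_sum_singleton add[OF nc_series_uminus] assms(2))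
  have right: "nc_comp \<phi> \<psi> = nc_id"
    unfolding \<psi>_def by (intro nc_comp_tree_sum_uminus add[OF assms(2)] Nil[OF assms(2)] assms(3))
  have "nc_comp \<psi> \<chi> = nc_id"
    unfolding \<chi>_def by (intro nc_comp_tree_sum_uminus add[OF series] Nil[OF series] \<psi>1)
  then have "\<phi> = nc_comp \<phi> (nc_comp \<psi> \<chi>)"
    by (simp add: nc_comp_id_right[OF add[OF assms(2)] Nil[OF assms(2)]])
  also have "\<dots> = nc_comp (nc_comp \<phi> \<psi>) \<chi>"
    using nc_comp_assoc[of \<phi> \<psi> \<chi>] add[OF assms(2)] Nil[OF assms(2)] Nil[OF series] by simp
  also have "\<dots> = \<chi>" using Nil[OF series'] by (simp add: right nc_comp_id_left)
  \<comment> \<open>As \<open>\<phi>\<close> equals \<open>\<chi>\<close>, the right inverse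
    identity for \<open>\<psi>\<close> becomes the missing left inverse identity for
    \<open>\<phi>\<close>.\<close>
  finally have inverse: "nc_inverse scale scale \<phi> \<psi>"
    using \<open>nc_comp \<psi> \<chi> = nc_id\<close> right series by (simp add: nc_inverse_def)
  \<comment> \<open>A left inverse agrees with a right inverse; uniqueness is what evaluates the
    definite description in \<open>nc_inv\<close>.\<close>
  have unique: "\<eta> = \<psi>" if "nc_inverse scale scale \<phi> \<eta>" for \<eta>
  proof -
    have \<eta>: "nc_series scale scale \<eta>" "nc_comp \<eta> \<phi> = nc_id" using that by (auto simp: nc_inverse_def)
    have "\<eta> = nc_comp \<eta> (nc_comp \<phi> \<psi>)"
      by (simp add: right nc_comp_id_right[OF add[OF \<eta>(1)] Nil[OF \<eta>(1)]])
    also have "\<dots> = nc_comp (nc_comp \<eta> \<phi>) \<psi>"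
      using nc_comp_assoc[of \<eta> \<phi> \<psi>] add[OF \<eta>(1)] Nil[OF \<eta>(1)] Nil[OF assms(2)] by simp
    finally show ?thesis using Nil[OF series] by (simp add: \<eta>(2) nc_comp_id_left)
  qed
  have "nc_inv scale scale \<phi> = \<psi>"
    unfolding nc_inv_def using inverse unique by (rule the_equality)
  moreover have "\<psi> vs = (\<Sum>T | num_leaves T = length vs \<and> (\<forall>p\<in>vertices T. valency T p \<ge> 3).
          scale ((-1) ^ card (vertices T)) (tree_map \<phi> T vs))" for vs
    by (simp add: \<psi>_def tree_sum_def reduced_trees_def tree_map_uminus[OF assms(2)])
  ultimately show ?thesis
    using inverse \<psi>1 by (auto simp: nc_invertible_def)
qed

end
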